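(* Let $d\ge 4$ be an integer. The set of matrices in $ESL_2(\mathbb{Z}/\bar d\mathbb{Z})$ having determinant $+1$ and trace $d-1$ consists of: (1) the single conjugacy class $[F_z]$ if $d\not\equiv 3,6\pmod 9$; (2) the two disjoint conjugacy classes $[F_z]$, $[F_a]$ if $d\equiv 3\pmod 9$; (3) the two disjoint conjugacy classes $[F_z]$, $[F_a']$ if $d\equiv 6\pmod 9$, where $[F]$ denotes the conjugacy class of $F$ in the group $ESL_2(\mathbb{Z}/\bar d\mathbb{Z})$.
   Context: $\bar d=d$ if $d$ is odd and $\bar d=2d$ if $d$ is even. $ESL_2(\mathbb{Z}/\bar d\mathbb{Z})$ is the group of matrices in $GL_2(\mathbb{Z}/\bar d\mathbb{Z})$ with determinant $\pm1$. Define (entries read modulo $\bar d$) $F_z=\begin{pmatrix}0&d-1\\ d+1&d-1\end{pmatrix}$; if $d\equiv 3\pmod 9$, $F_a=\begin{pmatrix}1&d+3\\ \frac{4d-3}{3}&d-2\end{pmatrix}$; if $d\equiv 6\pmod 9$, $F_a'=\begin{pmatrix}1&d+3\\ \frac{2d-3}{3}&d-2\end{pmatrix}$. *)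

theory Defs
  imports "HOL-Analysis.Determinants" "HOL-Analysis.Cartesian_Euclidean_Space"
    "HOL-Algebra.Group" "HOL-Number_Theory.Residues"
begin

text \<open>
  A matrix over the integers modulo \<open>n\<close> is represented by its unique integer representative with
  entries in the carrier \<open>{0..n - 1}\<close> of \<^const>\<open>residue_ring\<close>. Determinant and trace of the class
  are those of the representative, read modulo \<open>n\<close>.
\<close>

definition dbar :: "int \<Rightarrow> int"
  where "dbar d = (if odd d then d else 2 * d)"

definition mat_red :: "int \<Rightarrow> int^2^2 \<Rightarrow> int^2^2"
  where "mat_red n A = (\<chi> i j. A $ i $ j mod n)"

definition mat2 :: "int \<Rightarrow> int \<Rightarrow> int \<Rightarrow> int \<Rightarrow> int^2^2"
  where "mat2 a b c e = vector [vector [a, b], vector [c, e]]"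

definition M2 :: "int \<Rightarrow> (int^2^2) monoid"
  where "M2 n = \<lparr>carrier = {A. \<forall>i j. A $ i $ j \<in> carrier (residue_ring n)},
                 monoid.mult = (\<lambda>A B. mat_red n (A ** B)),
                 one = mat_red n (mat 1)\<rparr>"

definition GL2 :: "int \<Rightarrow> (int^2^2) monoid"
  where "GL2 n = units_of (M2 n)"

definition ESL2 :: "int \<Rightarrow> (int^2^2) monoid"
  where "ESL2 n = (GL2 n)\<lparr>carrier :=
           {A \<in> carrier (GL2 n). [det A = 1] (mod n) \<or> [det A = -1] (mod n)}\<rparr>"

definition conjugacy_class :: "('a, 'b) monoid_scheme \<Rightarrow> 'a \<Rightarrow> 'a set"
  where "conjugacy_class G x = {g \<otimes>\<^bsub>G\<^esub> x \<otimes>\<^bsub>G\<^esub> inv\<^bsub>G\<^esub> g | g. g \<in> carrier G}"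

definition Fz :: "int \<Rightarrow> int^2^2"
  where "Fz d = mat_red (dbar d) (mat2 0 (d - 1) (d + 1) (d - 1))"

text \<open>In the next two definitions the division by 3 is exact when \<open>3 dvd d\<close>, the only case in which
  they are used.\<close>

definition Fa :: "int \<Rightarrow> int^2^2"
  where "Fa d = mat_red (dbar d) (mat2 1 (d + 3) ((4 * d - 3) div 3) (d - 2))"

definition Fa' :: "int \<Rightarrow> int^2^2"
  where "Fa' d = mat_red (dbar d) (mat2 1 (d + 3) ((2 * d - 3) div 3) (d - 2))"

lemma mat_red_nth [simp]: "mat_red n A $ i $ j = A $ i $ j mod n"
  by (simp add: mat_red_def)

lemma mult_nth_2: "((A :: int^2^2) ** B) $ i $ j = A $ i $ 1 * B $ 1 $ j + A $ i $ 2 * B $ 2 $ j"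
  by (simp add: matrix_matrix_mult_def sum_2)

lemma mat_red_mult_left: "mat_red n (mat_red n A ** B) = mat_red n (A ** B)"
  unfolding vec_eq_iff mat_red_nth mult_nth_2 cong_def[symmetric]
  by (intro allI cong_add cong_mult) (simp_all add: cong_def)

lemma mat_red_mult_right: "mat_red n (A ** mat_red n B) = mat_red n (A ** B)"
  unfolding vec_eq_iff mat_red_nth mult_nth_2 cong_def[symmetric]
  by (intro allI cong_add cong_mult) (simp_all add: cong_def)

lemma carrier_M2: "n > 0 \<Longrightarrow> A \<in> carrier (M2 n) \<longleftrightarrow> mat_red n A = A"
proof -
  assume n: "n > 0"
  have "x \<in> carrier (residue_ring n) \<longleftrightarrow> x mod n = x" for x
    using n pos_mod_bound[OF n, of x] pos_mod_sign[OF n, of x]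
    by (auto simp: residue_ring_def mod_pos_pos_trivial simp del: pos_mod_bound pos_mod_sign)
  then show ?thesis by (simp add: M2_def vec_eq_iff)
qed

lemma det_mat_red: "[det (mat_red n A) = det A] (mod n)"
  unfolding det_2 mat_red_nth
  by (intro cong_diff cong_mult) (simp_all add: cong_def)

lemma monoid_M2:
  assumes "n > 0"
  shows "monoid (M2 n)"
proof -
  have idem: "mat_red n (mat_red n A) = mat_red n A" for A
    by (simp add: vec_eq_iff)
  show ?thesis
  proof (rule monoidI)
    fix x y z assume "x \<in> carrier (M2 n)" "y \<in> carrier (M2 n)" "z \<in> carrier (M2 n)"
    show "x \<otimes>\<^bsub>M2 n\<^esub> y \<in> carrier (M2 n)"
      unfolding carrier_M2[OF assms] by (simp add: M2_def idem)
    show "x \<otimes>\<^bsub>M2 n\<^esub> y \<otimes>\<^bsub>M2 n\<^esub> z = x \<otimes>\<^bsub>M2 n\<^esub> (y \<otimes>\<^bsub>M2 n\<^esub> z)"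
      by (simp add: M2_def mat_red_mult_left mat_red_mult_right matrix_mul_assoc)
  next
    show "\<one>\<^bsub>M2 n\<^esub> \<in> carrier (M2 n)"
      unfolding carrier_M2[OF assms] by (simp add: M2_def idem)
  next
    fix x assume x: "x \<in> carrier (M2 n)"
    then show "\<one>\<^bsub>M2 n\<^esub> \<otimes>\<^bsub>M2 n\<^esub> x = x" "x \<otimes>\<^bsub>M2 n\<^esub> \<one>\<^bsub>M2 n\<^esub> = x"
      unfolding carrier_M2[OF assms] by (simp_all add: M2_def mat_red_mult_left mat_red_mult_right)
  qed
qed

lemma group_GL2: "n > 0 \<Longrightarrow> group (GL2 n)"
  unfolding GL2_def by (intro monoid.units_group monoid_M2)

lemma det_mult_GL2: "[det (A \<otimes>\<^bsub>GL2 n\<^esub> B) = det A * det B] (mod n)"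
  using det_mat_red[of n "A ** B"] by (simp add: GL2_def units_of_def M2_def det_mul)

lemma det_one_GL2: "[det \<one>\<^bsub>GL2 n\<^esub> = 1] (mod n)"
  using det_mat_red[of n "mat 1"] by (simp add: GL2_def units_of_def M2_def)

lemma group_ESL2:
  assumes "n > 0"
  shows "group (ESL2 n)"
proof -
  interpret group "GL2 n" by (rule group_GL2[OF assms])
  let ?H = "{A \<in> carrier (GL2 n). [det A = 1] (mod n) \<or> [det A = -1] (mod n)}"
  have "subgroup ?H (GL2 n)"
  proof (rule subgroupI)
    show "?H \<subseteq> carrier (GL2 n)" by auto
    show "?H \<noteq> {}" using det_one_GL2[of n] by blast
  next
    fix A assume A: "A \<in> ?H"
    have "[det A * det (inv\<^bsub>GL2 n\<^esub> A) = 1] (mod n)"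
      using A det_mult_GL2[of n A "inv\<^bsub>GL2 n\<^esub> A"] det_one_GL2[of n]
      by (auto intro: cong_trans cong_sym)
    then have "[det (inv\<^bsub>GL2 n\<^esub> A) = 1] (mod n) \<or> [det (inv\<^bsub>GL2 n\<^esub> A) = -1] (mod n)"
    proof -
      consider "[det A = 1] (mod n)" | "[det A = -1] (mod n)" using A by auto
      then show ?thesis
      proof cases
        case 1
        then have "[det A * det (inv\<^bsub>GL2 n\<^esub> A) = 1 * det (inv\<^bsub>GL2 n\<^esub> A)] (mod n)"
          by (intro cong_mult cong_refl)
        with \<open>[det A * det (inv\<^bsub>GL2 n\<^esub> A) = 1] (mod n)\<close> show ?thesis
          by (auto simp: cong_def)
      next
        case 2
        then have "[det A * det (inv\<^bsub>GL2 n\<^esub> A) = -1 * det (inv\<^bsub>GL2 n\<^esub> A)] (mod n)"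
          by (intro cong_mult cong_refl)
        with \<open>[det A * det (inv\<^bsub>GL2 n\<^esub> A) = 1] (mod n)\<close>
        have "[- det (inv\<^bsub>GL2 n\<^esub> A) = - (-1)] (mod n)"
          by (auto simp: cong_def)
        then show ?thesis unfolding cong_minus_minus_iff by blast
      qed
    qed
    with A show "inv\<^bsub>GL2 n\<^esub> A \<in> ?H" by auto
  next
    fix A B assume AB: "A \<in> ?H" "B \<in> ?H"
    then obtain a b where ab: "a = 1 \<or> a = -1" "b = 1 \<or> b = -1"
      "[det A = a] (mod n)" "[det B = b] (mod n)" by blast
    have "[det (A \<otimes>\<^bsub>GL2 n\<^esub> B) = a * b] (mod n)"
      by (rule cong_trans[OF det_mult_GL2 cong_mult[OF ab(3,4)]])
    then show "A \<otimes>\<^bsub>GL2 n\<^esub> B \<in> ?H" using AB ab(1,2) by auto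
  qed
  then show ?thesis
    unfolding ESL2_def by (rule subgroup.subgroup_is_group) (rule is_group)
qed

end

theory Submission
  imports Defs
begin

text \<open>
  Let \<open>n = dbar d\<close> and let \<open>A\<close> have determinant 1 and trace \<open>t = d - 1\<close> modulo \<open>n\<close>. For a vector
  \<open>v\<close>, the determinant \<open>q(v) = det (v, A v)\<close> is a binary quadratic form of discriminant
  \<open>t\<^sup>2 - 4\<close>, which is \<open>-3\<close> modulo every odd prime divisor of \<open>n\<close> and odd if \<open>n\<close> is even. Where
  \<open>q(v) = \<plusminus> 1\<close>, the matrix \<open>(v, A v)\<close> lies in \<open>ESL2 n\<close> and conjugates \<open>A\<close> to its companion matrix.
  Modulo a prime other than 3 the form \<open>q\<close> is nondegenerate and takes every nonzero value; modulo 3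
  it takes one of the values \<open>\<plusminus> 1\<close> unless it vanishes identically, and this fixes the sign. Solutions
  lift to \<open>n\<close> one prime factor at a time. Finally, \<open>q\<close> vanishes modulo 3 only if \<open>A\<close> is the identity
  modulo 3; comparing determinant and trace modulo 9 excludes this when \<open>9 dvd d\<close>, and otherwise
  all such \<open>A\<close> are conjugate modulo \<open>n / 3\<close>, hence modulo \<open>n\<close> by the Chinese remainder theorem.
\<close>

section \<open>Values of binary quadratic forms modulo \<open>n\<close>\<close>

definition binary_form :: "int \<Rightarrow> int \<Rightarrow> int \<Rightarrow> int \<Rightarrow> int \<Rightarrow> int"
  where "binary_form a b c x y = a * x\<^sup>2 + b * x * y + c * y\<^sup>2"

lemma binary_form_cong:
  assumes "[x = x'] (mod n)" "[y = y'] (mod n)"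
  shows "[binary_form a b c x y = binary_form a b c x' y'] (mod n)"
  unfolding binary_form_def by (intro cong_add cong_mult cong_pow cong_refl assms)

text \<open>Equal values make \<open>p\<close> divide \<open>(x - y) * (x + y)\<close>. On the lower
  half of the residues both factors are smaller than \<open>p\<close> in absolute value, so one of
  them is 0, and a zero sum of nonnegative numbers also gives \<open>x = y\<close>.\<close>

lemma inj_on_square_mod_prime:
  fixes p :: int
  assumes "prime p" and D: "\<not> p dvd D"
  shows "inj_on (\<lambda>x. (D * x\<^sup>2 + R) mod p) {0..(p - 1) div 2}"
proof (rule inj_onI)
  fix x y assume x: "x \<in> {0..(p - 1) div 2}" and y: "y \<in> {0..(p - 1) div 2}"
    and eq: "(D * x\<^sup>2 + R) mod p = (D * y\<^sup>2 + R) mod p"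
  have p: "p > 1" using assms(1) by (simp add: prime_gt_1_int)
  from eq have "p dvd D * ((x - y) * (x + y))"
    by (simp add: mod_eq_dvd_iff algebra_simps power2_eq_square)
  then have "p dvd x - y \<or> p dvd x + y"
    using assms by (simp add: prime_dvd_mult_iff)
  moreover have "\<bar>x - y\<bar> < p" "\<bar>x + y\<bar> < p" "x \<ge> 0" "y \<ge> 0"
    using x y p by auto
  ultimately show "x = y"
    using zdvd_not_zless[of "x + y" p] dvd_imp_le_int[of "x - y" p] dvd_imp_le_int[of "x + y" p]
    by (cases "x - y = 0"; cases "x + y = 0"; force)
qed

text \<open>Pigeonhole: the values \<open>s^2\<close> and the values \<open>D * y^2 + R\<close> each
  fill \<open>(p + 1) / 2\<close> of the \<open>p\<close> residues, so the two sets meet.\<close>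

lemma diagonal_form_represents_mod_prime:
  fixes p :: int
  assumes p: "prime p" "odd p" and D: "\<not> p dvd D"
  shows "\<exists>s y. [s\<^sup>2 - D * y\<^sup>2 = R] (mod p)"
proof -
  let ?I = "{0..(p - 1) div 2}"
  \<comment> \<open>The shape \<open>1 * x^2 + 0\<close> makes the plain squares an instance of the
    same injectivity lemma.\<close>
  define X where "X = (\<lambda>x. (1 * x\<^sup>2 + 0) mod p) ` ?I"
  define Y where "Y = (\<lambda>x. (D * x\<^sup>2 + R) mod p) ` ?I"
  have p1: "p > 1" using p(1) by (simp add: prime_gt_1_int)
  have "card X = card ?I" unfolding X_def
    using inj_on_square_mod_prime[OF p(1), of 1 0] p1 by (intro card_image) auto
  moreover have "card Y = card ?I" unfolding Y_def
    using inj_on_square_mod_prime[OF p(1) D] by (intro card_image) auto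
  moreover have "2 * card ?I = nat p + 1"
    using p p1 by (auto elim!: oddE)
  moreover have "X \<union> Y \<subseteq> {0..<p}" using p1 by (auto simp: X_def Y_def)
  then have "card (X \<union> Y) \<le> nat p"
    using card_mono[of "{0..<p}"] by fastforce
  moreover have "finite X" "finite Y" by (auto simp: X_def Y_def)
  ultimately have "X \<inter> Y \<noteq> {}"
    using p1 card_Un_disjoint[of X Y] by auto
  then obtain s y where "(1 * s\<^sup>2 + 0) mod p = (D * y\<^sup>2 + R) mod p"
    by (auto simp: X_def Y_def)
  then have "[s\<^sup>2 - D * y\<^sup>2 = R] (mod p)"
    by (simp add: cong_def mod_eq_dvd_iff algebra_simps)
  then show ?thesis by blast
qed

lemma solve_linear_mod_prime:
  fixes p :: int
  assumes "prime p" "\<not> p dvd u"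
  shows "\<exists>x. [u * x = k] (mod p)"
proof -
  have "coprime u p" using assms by (metis coprime_commute prime_imp_coprime)
  then obtain z where "[u * z = 1] (mod p)" using cong_solve_coprime_int by blast
  then have "[u * z * k = 1 * k] (mod p)" by (intro cong_mult cong_refl)
  then show ?thesis by (auto simp: mult.assoc)
qed

text \<open>Completing the square: \<open>4 * a\<close> times the form is
  \<open>(2 * a * x + b * y)^2 - (b^2 - 4 * a * c) * y^2\<close>. The diagonal form represents
  \<open>4 * a * r\<close>, and \<open>x\<close> is recovered because \<open>2 * a\<close> is
  invertible modulo \<open>p\<close>.\<close>

lemma binary_form_represents_mod_prime_aux:
  fixes p :: int
  assumes p: "prime p" "odd p" and D: "\<not> p dvd b\<^sup>2 - 4 * a * c" and a: "\<not> p dvd a"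
  shows "\<exists>x y. [binary_form a b c x y = r] (mod p)"
proof -
  have 2: "\<not> p dvd 2" using p by (metis even_numeral prime_def primes_dvd_imp_eq two_is_prime)
  then have 4: "\<not> p dvd 4"
    using p(1) prime_dvd_mult_iff[of p 2 2] by simp
  obtain s y where sy: "[s\<^sup>2 - (b\<^sup>2 - 4 * a * c) * y\<^sup>2 = 4 * a * r] (mod p)"
    using diagonal_form_represents_mod_prime[OF p D] by blast
  obtain x where x: "[(2 * a) * x = s - b * y] (mod p)"
    using solve_linear_mod_prime[OF p(1), of "2 * a" "s - b * y"] p(1) 2 a by (auto simp: prime_dvd_mult_iff)
  have "[2 * a * x + b * y = s] (mod p)"
    using cong_add[OF x cong_refl[of "b * y"]] by simp
  then have "[(2 * a * x + b * y)\<^sup>2 - (b\<^sup>2 - 4 * a * c) * y\<^sup>2 = s\<^sup>2 - (b\<^sup>2 - 4 * a * c) * y\<^sup>2] (mod p)"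
    by (intro cong_diff cong_pow cong_refl)
  then have "[(2 * a * x + b * y)\<^sup>2 - (b\<^sup>2 - 4 * a * c) * y\<^sup>2 = 4 * a * r] (mod p)"
    using sy by (rule cong_trans)
  then have "p dvd 4 * a * (binary_form a b c x y - r)"
    by (simp add: cong_iff_dvd_diff binary_form_def algebra_simps power2_eq_square)
  then have "p dvd binary_form a b c x y - r"
    using p(1) a 4 by (simp add: prime_dvd_mult_iff)
  then show ?thesis by (auto simp: cong_iff_dvd_diff)
qed

lemma binary_form_represents_mod_prime:
  fixes p :: int
  assumes p: "prime p" "odd p" and D: "\<not> p dvd b\<^sup>2 - 4 * a * c"
  shows "\<exists>x y. [binary_form a b c x y = r] (mod p)"
proof -
  consider "\<not> p dvd a" | "\<not> p dvd c" | "p dvd a" "p dvd c" by blast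
  then show ?thesis
  proof cases
    case 1 then show ?thesis using binary_form_represents_mod_prime_aux[OF p D] by blast
  next
    case 2
    then obtain x y where "[binary_form c b a x y = r] (mod p)"
      using binary_form_represents_mod_prime_aux[OF p, of b c a r] D by (auto simp: mult_ac)
    then have "[binary_form a b c y x = r] (mod p)" by (simp add: binary_form_def ac_simps)
    then show ?thesis by blast
  next
    \<comment> \<open>The form reduces to \<open>b * x * y\<close> modulo \<open>p\<close>, which is
      linear in \<open>x\<close> at \<open>y = 1\<close>.\<close>
    case 3
    then have "\<not> p dvd b" using D by (auto simp: power2_eq_square)
    then obtain x where x: "[b * x = r] (mod p)" using solve_linear_mod_prime p(1) by blast
    have "[a * x\<^sup>2 + b * x + c = 0 * x\<^sup>2 + r + 0] (mod p)"
      using 3 x by (intro cong_add cong_mult cong_refl) (auto simp: cong_0_iff)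
    then have "[binary_form a b c x 1 = r] (mod p)" by (simp add: binary_form_def)
    then show ?thesis by blast
  qed
qed

text \<open>A Hensel step in two variables. Here \<open>u\<close> and \<open>v\<close> are the
  partial derivatives at \<open>(x, y)\<close>; a shift by \<open>m * (s, t)\<close> changes the
  value by \<open>m * (u * s + v * t)\<close> up to a multiple of \<open>m * m\<close>, which
  \<open>p * m\<close> divides since \<open>p dvd m\<close>.\<close>

lemma binary_form_lift:
  fixes p m :: int
  assumes p: "prime p" and pm: "p dvd m" and r: "\<not> p dvd r" and b: "p = 2 \<longrightarrow> odd b"
    and f: "[binary_form a b c x y = r] (mod m)"
  shows "\<exists>x y. [binary_form a b c x y = r] (mod p * m)"
proof -
  define u where "u = 2 * a * x + b * y"
  define v where "v = b * x + 2 * c * y"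
  have fp: "[binary_form a b c x y = r] (mod p)" using f pm by (rule cong_dvd_modulus)
  have uv: "\<not> p dvd u \<or> \<not> p dvd v"
  proof (rule ccontr)
    assume "\<not> ?thesis"
    then have uv: "p dvd u" "p dvd v" by auto
    have nf: "\<not> p dvd binary_form a b c x y"
      using fp r cong_dvd_iff by blast
    show False
    \<comment> \<open>Euler's identity \<open>x * u + y * v = 2 * f\<close> settles odd
      \<open>p\<close> but says nothing modulo 2. There, \<open>b\<close> being odd gives that
      \<open>u\<close> and \<open>v\<close> agree with \<open>y\<close> and \<open>x\<close>, and
      both being even makes the value even.\<close>
    proof (cases "p = 2")
      case True
      with uv b have "even y" "even x" by (auto simp: u_def v_def)
      with nf True show False by (auto simp: binary_form_def)
    next
      case False
      have "p dvd x * u + y * v" using uv by simp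
      also have "x * u + y * v = 2 * binary_form a b c x y"
        by (simp add: u_def v_def binary_form_def algebra_simps power2_eq_square)
      finally have "p dvd 2" using nf p by (simp add: prime_dvd_mult_iff)
      with False p show False by (metis primes_dvd_imp_eq two_is_prime)
    qed
  qed
  from f obtain k where k: "binary_form a b c x y = r + m * k"
    by (metis cong_iff_lin cong_sym mult.commute)
  \<comment> \<open>The shift has to cancel the error \<open>m * k\<close> modulo
    \<open>p * m\<close>. One derivative prime to \<open>p\<close> suffices, the other coordinate
    staying fixed.\<close>
  obtain s t where "[u * s + v * t = - k] (mod p)"
  proof (cases "p dvd u")
    case True
    then obtain t where "[v * t = - k] (mod p)" using solve_linear_mod_prime[OF p] uv by blast
    then show ?thesis using that[of 0 t] by simp
  next
    case False
    then obtain s where "[u * s = - k] (mod p)" using solve_linear_mod_prime[OF p] by blast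
    then show ?thesis using that[of s 0] by simp
  qed
  then obtain l where l: "u * s + v * t + k = p * l"
    by (auto simp: cong_iff_dvd_diff)
  obtain m' where m': "m = p * m'" using pm by blast
  have "binary_form a b c (x + m * s) (y + m * t) - r
      = binary_form a b c x y - r + m * (u * s + v * t) + m * m * binary_form a b c s t"
    by (simp add: u_def v_def binary_form_def algebra_simps power2_eq_square)
  also have "\<dots> = m * (u * s + v * t + k) + m * m * binary_form a b c s t"
    using k by (simp add: algebra_simps)
  also have "\<dots> = (p * m) * (l + m' * binary_form a b c s t)"
    unfolding l by (simp add: m' algebra_simps)
  finally show ?thesis by (metis cong_iff_dvd_diff dvd_triv_left)
qed

text \<open>Induction on the prime factorisation: a repeated prime is handled by lifting, a new one
  by the Chinese remainder theorem applied to each coordinate.\<close>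

lemma binary_form_represents:
  fixes n :: int
  assumes "n \<noteq> 0"
    and "\<And>p. prime p \<Longrightarrow> p dvd n \<Longrightarrow> \<not> p dvd r"
    and "even n \<Longrightarrow> odd b"
    and "\<And>p. prime p \<Longrightarrow> p dvd n \<Longrightarrow> \<exists>x y. [binary_form a b c x y = r] (mod p)"
  shows "\<exists>x y. [binary_form a b c x y = r] (mod n)"
  using assms
proof (induction n rule: prime_divisors_induct)
  case zero then show ?case by simp
next
  case (unit n) then show ?case
    by (metis cong_iff_dvd_diff unit_imp_dvd)
next
  case (factor p m)
  have "\<exists>x y. [binary_form a b c x y = r] (mod m)"
    using factor.prems by (intro factor.IH) auto
  then obtain x y where xy: "[binary_form a b c x y = r] (mod m)" by blast
  show ?case
  proof (cases "p dvd m")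
    case True
    then show ?thesis
      using binary_form_lift[OF factor.hyps True _ _ xy] factor.prems(2)[OF factor.hyps] factor.prems(3)
      by auto
  next
    case False
    then have cop: "coprime p m" using factor.hyps by (simp add: prime_imp_coprime)
    obtain x' y' where xy': "[binary_form a b c x' y' = r] (mod p)"
      using factor.prems(4)[OF factor.hyps] by auto
    obtain X where X: "[X = x'] (mod p)" "[X = x] (mod m)"
      using binary_chinese_remainder_int[OF cop] by blast
    obtain Y where Y: "[Y = y'] (mod p)" "[Y = y] (mod m)"
      using binary_chinese_remainder_int[OF cop] by blast
    have "[binary_form a b c X Y = r] (mod p)" "[binary_form a b c X Y = r] (mod m)"
      using binary_form_cong[OF X(1) Y(1)] xy' binary_form_cong[OF X(2) Y(2)] xy
      by (blast intro: cong_trans)+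
    then have "[binary_form a b c X Y = r] (mod p * m)"
      using cop coprime_cong_mult by blast
    then show ?thesis by blast
  qed
qed

text \<open>One sign must serve all primes at once. Only 3 restricts it, since both signs are
  represented modulo the other odd primes and coincide modulo 2; so \<open>r\<close> is chosen from
  a value of the form not divisible by 3 when \<open>3 dvd n\<close>.\<close>

lemma binary_form_represents_pm1:
  fixes n :: int
  assumes n: "n \<noteq> 0" and b: "even n \<Longrightarrow> odd b"
    and D: "\<And>p. prime p \<Longrightarrow> p dvd n \<Longrightarrow> p dvd b\<^sup>2 - 4 * a * c \<Longrightarrow> p = 3"
    and 3: "\<not> (3 dvd n \<and> 3 dvd a \<and> 3 dvd b \<and> 3 dvd c)"
  shows "\<exists>r x y. (r = 1 \<or> r = -1) \<and> [binary_form a b c x y = r] (mod n)"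
proof -
  have "\<exists>r. (r = 1 \<or> r = -1) \<and> (3 dvd n \<longrightarrow> (\<exists>x y. [binary_form a b c x y = r] (mod 3)))"
  proof (cases "3 dvd n")
    case True
    obtain x y where xy: "\<not> 3 dvd binary_form a b c x y"
    proof -
      \<comment> \<open>These three values are \<open>a\<close>, \<open>c\<close> and
        \<open>a + b + c\<close>; their vanishing modulo 3 would force that of all coefficients. The
        same three points serve for the prime 2 below.\<close>
      have "\<not> (3 dvd binary_form a b c 1 0 \<and> 3 dvd binary_form a b c 0 1 \<and> 3 dvd binary_form a b c 1 1)"
        using 3 True unfolding binary_form_def by simp presburger
      then show ?thesis using that by blast
    qed
    moreover have "\<not> 3 dvd z \<Longrightarrow> [z = 1] (mod 3) \<or> [z = -1] (mod 3)" for z :: int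
      unfolding cong_iff_dvd_diff by presburger
    ultimately show ?thesis by blast
  qed auto
  then obtain r :: int where r: "r = 1 \<or> r = -1"
    and r3: "3 dvd n \<longrightarrow> (\<exists>x y. [binary_form a b c x y = r] (mod 3))" by blast
  have "\<exists>x y. [binary_form a b c x y = r] (mod n)"
  proof (rule binary_form_represents[OF n])
    fix p :: int assume p: "prime p" "p dvd n"
    show "\<not> p dvd r" using r p(1) not_prime_unit by auto
    consider "p = 2" | "p = 3" | "odd p" "\<not> p dvd b\<^sup>2 - 4 * a * c"
      using p D by (metis primes_dvd_imp_eq two_is_prime)
    then show "\<exists>x y. [binary_form a b c x y = r] (mod p)"
    proof cases
      case 1
      then have "odd b" using b p by simp
      then have "odd (binary_form a b c 1 0) \<or> odd (binary_form a b c 0 1) \<or> odd (binary_form a b c 1 1)"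
        by (auto simp: binary_form_def)
      then obtain x y where "odd (binary_form a b c x y)" by blast
      then have "[binary_form a b c x y = r] (mod 2)"
        using r by (auto simp: cong_iff_dvd_diff)
      then show ?thesis using 1 by blast
    next
      case 2 then show ?thesis using r3 p by blast
    next
      case 3 then show ?thesis using binary_form_represents_mod_prime p by blast
    qed
  qed (rule b)
  then show ?thesis using r by blast
qed

section \<open>Conjugacy in groups and in \<open>ESL2 n\<close>\<close>

text \<open>Clearing the inverse lets conjugacy of matrices be checked as a congruence between two
  products.\<close>

lemma (in group) mem_conjugacy_class_iff:
  assumes "x \<in> carrier G"
  shows "y \<in> conjugacy_class G x \<longleftrightarrow> y \<in> carrier G \<and> (\<exists>g\<in>carrier G. y \<otimes> g = g \<otimes> x)"
proof -
  have "y = g \<otimes> x \<otimes> inv g \<longleftrightarrow> y \<otimes> g = g \<otimes> x" if "g \<in> carrier G" "y \<in> carrier G" for g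
    using that assms by (metis inv_solve_right m_closed)
  then show ?thesis
    unfolding conjugacy_class_def using assms by blast
qed

lemma (in group) conjugacy_class_trans:
  assumes "x \<in> carrier G" "y \<in> conjugacy_class G x" "z \<in> conjugacy_class G y"
  shows "z \<in> conjugacy_class G x"
proof -
  obtain g where g: "g \<in> carrier G" "y \<in> carrier G" "y \<otimes> g = g \<otimes> x"
    using assms mem_conjugacy_class_iff by blast
  obtain h where h: "h \<in> carrier G" "z \<in> carrier G" "z \<otimes> h = h \<otimes> y"
    using assms g mem_conjugacy_class_iff by blast
  have "z \<otimes> (h \<otimes> g) = (h \<otimes> g) \<otimes> x"
    using g h assms(1) by (metis m_assoc)
  then show ?thesis using g h assms(1) by (auto simp: mem_conjugacy_class_iff)
qed

lemma (in group) conjugacy_class_sym: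
  assumes "x \<in> carrier G" "y \<in> conjugacy_class G x"
  shows "x \<in> conjugacy_class G y"
proof -
  obtain g where g: "g \<in> carrier G" "y \<in> carrier G" "y \<otimes> g = g \<otimes> x"
    using assms mem_conjugacy_class_iff by blast
  then have "x \<otimes> inv g = inv g \<otimes> y"
    using assms(1) by (metis inv_closed inv_solve_left inv_solve_right m_assoc m_closed)
  then show ?thesis using g assms(1) by (auto simp: mem_conjugacy_class_iff intro!: bexI[of _ "inv g"])
qed

lemma mat_red_mat_red [simp]: "mat_red n (mat_red n A) = mat_red n A"
  by (simp add: vec_eq_iff)

lemma mat_red_eq_iff: "mat_red n A = mat_red n B \<longleftrightarrow> (\<forall>i j. [A $ i $ j = B $ i $ j] (mod n))"
  by (simp add: vec_eq_iff cong_def)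

lemma mat2_nth [simp]:
  "mat2 a b c e $ 1 $ 1 = a" "mat2 a b c e $ 1 $ 2 = b"
  "mat2 a b c e $ 2 $ 1 = c" "mat2 a b c e $ 2 $ 2 = e"
  by (simp_all add: mat2_def)

lemma trace_2: "trace (A :: int^2^2) = A $ 1 $ 1 + A $ 2 $ 2"
  by (simp add: trace_def sum_2)

lemma trace_mat_red: "[trace (mat_red n A) = trace A] (mod n)"
  unfolding trace_2 mat_red_nth by (intro cong_add) (simp_all add: cong_def)

lemma det_cong_mat_red: "mat_red n A = mat_red n B \<Longrightarrow> [det A = det B] (mod n)"
  using det_mat_red[of n A] det_mat_red[of n B] by (metis cong_sym cong_trans)

lemma ESL2_mult: "A \<otimes>\<^bsub>ESL2 n\<^esub> B = mat_red n (A ** B)"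
  by (simp add: ESL2_def GL2_def units_of_def M2_def)

lemma ESL2_mat_red: "n > 0 \<Longrightarrow> A \<in> carrier (ESL2 n) \<Longrightarrow> mat_red n A = A"
  using carrier_M2[of n A] by (auto simp: ESL2_def GL2_def units_of_def Units_def)

lemma ESL2_det: "A \<in> carrier (ESL2 n) \<Longrightarrow> [det A = 1] (mod n) \<or> [det A = -1] (mod n)"
  by (auto simp: ESL2_def)

lemma mat_red_in_ESL2:
  assumes n: "n > 0" and A: "[det A = 1] (mod n) \<or> [det A = -1] (mod n)"
  shows "mat_red n A \<in> carrier (ESL2 n)"
proof -
  obtain r where r: "r * r = 1" "[det A = r] (mod n)"
    using A by (metis mult_1 mult_minus1 minus_minus)
  \<comment> \<open>\<open>B\<close> is \<open>r\<close> times the adjugate of \<open>A\<close>, an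
    inverse modulo \<open>n\<close> because \<open>r * det A\<close> is congruent to 1.\<close>
  define B where "B = mat2 (r * A $ 2 $ 2) (- r * A $ 1 $ 2) (- r * A $ 2 $ 1) (r * A $ 1 $ 1)"
  have rd: "[r * det A = 1] (mod n)"
    using cong_mult[OF cong_refl[of r] r(2)] r(1) by simp
  have "mat_red n (A ** B) = mat_red n (mat 1)" "mat_red n (B ** A) = mat_red n (mat 1)"
    using rd by (auto simp: mat_red_eq_iff forall_2 mult_nth_2 B_def mat_def det_2 algebra_simps)
  then have "mat_red n A \<in> Units (M2 n)"
    unfolding Units_def using carrier_M2[OF n]
    by (auto simp: M2_def mat_red_mult_left mat_red_mult_right intro!: exI[of _ "mat_red n B"])
  moreover have "[det (mat_red n A) = 1] (mod n) \<or> [det (mat_red n A) = -1] (mod n)"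
    using A det_mat_red cong_trans by blast
  ultimately show ?thesis by (simp add: ESL2_def GL2_def units_of_def)
qed

text \<open>The conjugator may be an unreduced integer matrix, so it can be given by formulas, glued
  from residues, or reduced modulo a divisor of \<open>n\<close>.\<close>

lemma mem_conjugacy_class_ESL2_iff:
  assumes n: "n > 0" and A: "[det A = 1] (mod n)" and B: "[det B = 1] (mod n)"
  shows "mat_red n A \<in> conjugacy_class (ESL2 n) (mat_red n B) \<longleftrightarrow>
    (\<exists>g. ([det g = 1] (mod n) \<or> [det g = -1] (mod n)) \<and> mat_red n (A ** g) = mat_red n (g ** B))"
proof -
  interpret group "ESL2 n" by (rule group_ESL2[OF n])
  have AB: "mat_red n A \<in> carrier (ESL2 n)" "mat_red n B \<in> carrier (ESL2 n)"
    using A B n mat_red_in_ESL2 by blast+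
  show ?thesis
    unfolding mem_conjugacy_class_iff[OF AB(2)] ESL2_mult mat_red_mult_left mat_red_mult_right
  proof safe
    fix g assume "g \<in> carrier (ESL2 n)" "mat_red n (A ** g) = mat_red n (g ** B)"
    then show "\<exists>g. ([det g = 1] (mod n) \<or> [det g = -1] (mod n)) \<and> mat_red n (A ** g) = mat_red n (g ** B)"
      using ESL2_det by blast
  next
    fix g assume g: "mat_red n (A ** g) = mat_red n (g ** B)"
    assume "[det g = 1] (mod n)"
    then have "mat_red n g \<in> carrier (ESL2 n)" using mat_red_in_ESL2[OF n] by blast
    then show "\<exists>g\<in>carrier (ESL2 n). mat_red n (A ** g) = mat_red n (g ** B)"
      using g by (intro bexI[of _ "mat_red n g"]) (auto simp: mat_red_mult_left mat_red_mult_right)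
  next
    fix g assume g: "mat_red n (A ** g) = mat_red n (g ** B)"
    assume "[det g = -1] (mod n)"
    then have "mat_red n g \<in> carrier (ESL2 n)" using mat_red_in_ESL2[OF n] by blast
    then show "\<exists>g\<in>carrier (ESL2 n). mat_red n (A ** g) = mat_red n (g ** B)"
      using g by (intro bexI[of _ "mat_red n g"]) (auto simp: mat_red_mult_left mat_red_mult_right)
  qed (use AB in auto)
qed

text \<open>Determinant and trace allow the inverse \<open>h\<close> to be moved from the right of
  \<open>g ** B\<close> to its left, where the product reduces to \<open>B\<close>.\<close>

lemma conjugacy_class_ESL2_det_trace:
  assumes n: "n > 0" and B: "B \<in> carrier (ESL2 n)" and A: "A \<in> conjugacy_class (ESL2 n) B"
  shows "A \<in> carrier (ESL2 n)" "[det A = det B] (mod n)" "[trace A = trace B] (mod n)"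
proof -
  interpret group "ESL2 n" by (rule group_ESL2[OF n])
  obtain g where g: "g \<in> carrier (ESL2 n)" and A': "A = g \<otimes>\<^bsub>ESL2 n\<^esub> B \<otimes>\<^bsub>ESL2 n\<^esub> inv\<^bsub>ESL2 n\<^esub> g"
    using A by (auto simp: conjugacy_class_def)
  define h where "h = inv\<^bsub>ESL2 n\<^esub> g"
  have h: "h \<in> carrier (ESL2 n)" using g by (simp add: h_def)
  show "A \<in> carrier (ESL2 n)" using A' g B by simp
  have A2: "A = mat_red n ((g ** B) ** h)"
    by (simp add: A' h_def ESL2_mult mat_red_mult_left)
  have "h \<otimes>\<^bsub>ESL2 n\<^esub> (g \<otimes>\<^bsub>ESL2 n\<^esub> B) = B"
    using g B by (simp add: h_def m_assoc[symmetric])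
  then have hgB: "mat_red n (h ** (g ** B)) = B"
    by (simp add: ESL2_mult mat_red_mult_right)
  have "[det A = det (h ** (g ** B))] (mod n)"
    unfolding A2 using det_mat_red[of n "(g ** B) ** h"] by (simp add: det_mul mult_ac)
  then show "[det A = det B] (mod n)"
    using det_mat_red[of n "h ** (g ** B)"] unfolding hgB by (metis cong_sym cong_trans)
  have "[trace A = trace (h ** (g ** B))] (mod n)"
    unfolding A2 using trace_mat_red[of n "(g ** B) ** h"] by (simp add: trace_mul_sym[of h])
  then show "[trace A = trace B] (mod n)"
    using trace_mat_red[of n "h ** (g ** B)"] unfolding hgB by (metis cong_sym cong_trans)
qed

section \<open>Conjugacy to the companion matrix\<close>

lemma conjugate_to_companion:
  assumes n: "n > 0" and det: "[det A = 1] (mod n)" and tr: "[trace A = t] (mod n)"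
    and t: "even n \<Longrightarrow> odd t"
    and D: "\<And>p. prime p \<Longrightarrow> p dvd n \<Longrightarrow> p dvd t\<^sup>2 - 4 \<Longrightarrow> p = 3"
    and 3: "\<not> (3 dvd n \<and> 3 dvd A $ 1 $ 2 \<and> 3 dvd A $ 2 $ 1 \<and> 3 dvd A $ 2 $ 2 - A $ 1 $ 1)"
  shows "mat_red n A \<in> conjugacy_class (ESL2 n) (mat_red n (mat2 0 (-1) 1 t))"
proof -
  define a b c e where abce: "a = A $ 1 $ 1" "b = A $ 1 $ 2" "c = A $ 2 $ 1" "e = A $ 2 $ 2"
  have det': "[a * e - b * c = 1] (mod n)" and tr': "[a + e = t] (mod n)"
    using det tr by (simp_all add: abce det_2 trace_2)
  \<comment> \<open>The discriminant of the characteristic polynomial equals that of the form used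
    below.\<close>
  have "[(a + e)\<^sup>2 - 4 * (a * e - b * c) = t\<^sup>2 - 4 * 1] (mod n)"
    by (intro cong_diff cong_mult cong_pow cong_refl det' tr')
  then have disc: "[(e - a)\<^sup>2 - 4 * c * (- b) = t\<^sup>2 - 4] (mod n)"
    by (simp add: power2_eq_square algebra_simps)
  \<comment> \<open>With \<open>v = (x, y)\<close>, this form is the determinant of the matrix with
    columns \<open>v\<close> and \<open>A v\<close>, the later \<open>g\<close>.\<close>
  have "\<exists>r x y. (r = 1 \<or> r = -1) \<and> [binary_form c (e - a) (- b) x y = r] (mod n)"
  proof (rule binary_form_represents_pm1)
    show "n \<noteq> 0" using n by simp
    show "odd (e - a)" if "even n"
      using cong_dvd_modulus[OF tr' that] t[OF that]
      by (auto simp: cong_iff_dvd_diff)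
    show "p = 3" if "prime p" "p dvd n" "p dvd (e - a)\<^sup>2 - 4 * c * (- b)" for p
      using D[OF that(1,2)] that(3) cong_dvd_iff[OF cong_dvd_modulus[OF disc that(2)]] by blast
    show "\<not> (3 dvd n \<and> 3 dvd c \<and> 3 dvd e - a \<and> 3 dvd - b)"
      using 3 by (auto simp: abce)
  qed
  then obtain r x y where r: "r = 1 \<or> r = -1" and f: "[binary_form c (e - a) (- b) x y = r] (mod n)"
    by blast
  define g where "g = mat2 x (a * x + b * y) y (c * x + e * y)"
  have "det g = binary_form c (e - a) (- b) x y"
    by (simp add: g_def det_2 binary_form_def power2_eq_square algebra_simps)
  then have "[det g = 1] (mod n) \<or> [det g = -1] (mod n)" using f r by auto
  moreover have "mat_red n (A ** g) = mat_red n (g ** mat2 0 (-1) 1 t)"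
  proof -
    \<comment> \<open>Cayley-Hamilton applied to \<open>v\<close>, one coordinate at a time:
      \<open>A (A v) = t * A v - v\<close> modulo \<open>n\<close>. This is the second column of
      \<open>A ** g\<close>.\<close>
    have CH: "[a * u + b * v = t * u - z] (mod n)"
      if "u = a * x + b * y" "v = c * x + e * y" "z = x" for u v z
    proof -
      have "[(a + e) * u - (a * e - b * c) * x = t * u - 1 * x] (mod n)"
        by (intro cong_diff cong_mult cong_refl tr' det')
      then show ?thesis by (simp add: that algebra_simps)
    qed
    have CH': "[c * u + e * v = t * v - z] (mod n)"
      if "u = a * x + b * y" "v = c * x + e * y" "z = y" for u v z
    proof -
      have "[(a + e) * v - (a * e - b * c) * y = t * v - 1 * y] (mod n)"
        by (intro cong_diff cong_mult cong_refl tr' det')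
      then show ?thesis by (simp add: that algebra_simps)
    qed
    show ?thesis
      unfolding mat_red_eq_iff forall_2 mult_nth_2 g_def mat2_nth
      using CH[OF refl refl refl] CH'[OF refl refl refl] by (simp add: abce mult.commute)
  qed
  ultimately show ?thesis
    using mem_conjugacy_class_ESL2_iff[OF n det, of "mat2 0 (-1) 1 t"] by (auto simp: det_2)
qed

text \<open>Both matrices are conjugate to the same companion matrix, which depends on
  \<open>t\<close> alone.\<close>

lemma conjugate_nonscalar_mod_3:
  assumes n: "n > 0" and t: "even n \<Longrightarrow> odd t"
    and D: "\<And>p. prime p \<Longrightarrow> p dvd n \<Longrightarrow> p dvd t\<^sup>2 - 4 \<Longrightarrow> p = 3"
    and A: "[det A = 1] (mod n)" "[trace A = t] (mod n)"
      "\<not> (3 dvd n \<and> 3 dvd A $ 1 $ 2 \<and> 3 dvd A $ 2 $ 1 \<and> 3 dvd A $ 2 $ 2 - A $ 1 $ 1)"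
    and B: "[det B = 1] (mod n)" "[trace B = t] (mod n)"
      "\<not> (3 dvd n \<and> 3 dvd B $ 1 $ 2 \<and> 3 dvd B $ 2 $ 1 \<and> 3 dvd B $ 2 $ 2 - B $ 1 $ 1)"
  shows "mat_red n A \<in> conjugacy_class (ESL2 n) (mat_red n B)"
proof -
  interpret group "ESL2 n" by (rule group_ESL2[OF n])
  have C: "mat_red n (mat2 0 (-1) 1 t) \<in> carrier (ESL2 n)" "mat_red n B \<in> carrier (ESL2 n)"
    using mat_red_in_ESL2[OF n] B(1) by (auto simp: det_2)
  show ?thesis
    using conjugacy_class_trans[OF C(2) conjugacy_class_sym[OF C(1)]]
      conjugate_to_companion[OF n A(1,2) t D A(3)] conjugate_to_companion[OF n B(1,2) t D B(3)] by blast
qed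

section \<open>Gluing conjugators modulo 3 and modulo a coprime \<open>m\<close>\<close>

lemma mat_red_coprime_mult:
  assumes "coprime k m" "mat_red k A = mat_red k B" "mat_red m A = mat_red m B"
  shows "mat_red (k * m) A = mat_red (k * m) B"
  using assms by (auto simp: mat_red_eq_iff intro: coprime_cong_mult)

lemma mat_red_chinese_remainder:
  assumes "coprime k m"
  shows "\<exists>X. mat_red k X = mat_red k A \<and> mat_red m X = mat_red m B"
proof -
  have "\<forall>i j. \<exists>x. [x = A $ i $ j] (mod k) \<and> [x = B $ i $ j] (mod m)"
    using binary_chinese_remainder_int[OF assms] by blast
  then obtain f where "\<forall>i j. [f i j = A $ i $ j] (mod k) \<and> [f i j = B $ i $ j] (mod m)"
    by metis
  then show ?thesis by (intro exI[of _ "\<chi> i j. f i j"]) (simp add: mat_red_eq_iff)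
qed

text \<open>Modulo \<open>m\<close> the exceptional prime 3 is absent, so a conjugator exists;
  modulo 3 both matrices are the identity and any matrix intertwines them.\<close>

lemma conjugate_identity_mod_3:
  assumes m: "m > 0" "coprime 3 m" and t: "even m \<Longrightarrow> odd t"
    and D: "\<And>p. prime p \<Longrightarrow> p dvd m \<Longrightarrow> p dvd t\<^sup>2 - 4 \<Longrightarrow> p = 3"
    and A: "[det A = 1] (mod 3 * m)" "[trace A = t] (mod 3 * m)" "mat_red 3 A = mat_red 3 (mat 1)"
    and B: "[det B = 1] (mod 3 * m)" "[trace B = t] (mod 3 * m)" "mat_red 3 B = mat_red 3 (mat 1)"
  shows "mat_red (3 * m) A \<in> conjugacy_class (ESL2 (3 * m)) (mat_red (3 * m) B)"
proof -
  have 3: "\<not> 3 dvd m" using coprime_common_divisor[OF m(2), of 3] by auto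
  have mA: "[det A = 1] (mod m)" "[trace A = t] (mod m)" and mB: "[det B = 1] (mod m)" "[trace B = t] (mod m)"
    using A B by (auto intro: cong_dvd_modulus)
  have "mat_red m A \<in> conjugacy_class (ESL2 m) (mat_red m B)"
    by (rule conjugate_nonscalar_mod_3[OF m(1) t D mA _ mB]) (use 3 in auto)
  then obtain g r where r: "r = 1 \<or> r = -1" "[det g = r] (mod m)"
    and g: "mat_red m (A ** g) = mat_red m (g ** B)"
    unfolding mem_conjugacy_class_ESL2_iff[OF m(1) mA(1) mB(1)] by blast
  \<comment> \<open>The free choice modulo 3 is spent on the determinant: it must be the same sign
    \<open>r\<close> as modulo \<open>m\<close>, for otherwise the glued determinant would not be 1
    or -1 modulo \<open>3 * m\<close>.\<close>
  obtain X where X3: "mat_red 3 X = mat_red 3 (mat2 r 0 0 1)" and Xm: "mat_red m X = mat_red m g"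
    using mat_red_chinese_remainder[OF m(2)] by blast
  have "[det X = r] (mod 3)" using det_cong_mat_red[OF X3] by (simp add: det_2)
  moreover have "[det X = r] (mod m)" using det_cong_mat_red[OF Xm] r(2) cong_trans by blast
  ultimately have "[det X = r] (mod 3 * m)" using m(2) by (rule coprime_cong_mult)
  moreover have "mat_red (3 * m) (A ** X) = mat_red (3 * m) (X ** B)"
  proof (rule mat_red_coprime_mult[OF m(2)])
    show "mat_red 3 (A ** X) = mat_red 3 (X ** B)"
      using A(3) B(3) by (metis mat_red_mult_left mat_red_mult_right matrix_mul_lid matrix_mul_rid)
    show "mat_red m (A ** X) = mat_red m (X ** B)"
      using Xm g by (metis mat_red_mult_left mat_red_mult_right)
  qed
  ultimately show ?thesis
    using mem_conjugacy_class_ESL2_iff[of "3 * m" A B] m(1) A(1) B(1) r(1) by auto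
qed

section \<open>The modulus \<open>dbar d\<close>, the representatives and the prime 3\<close>

lemma dbar_pos: "d \<ge> 4 \<Longrightarrow> dbar d > 0"
  by (simp add: dbar_def)

lemma dbar_dvd_iff_3: "3 dvd dbar d \<longleftrightarrow> 3 dvd d"
  unfolding dbar_def by presburger

lemma even_dbar: "even (dbar d) \<Longrightarrow> odd (d - 1)"
  by (auto simp: dbar_def split: if_splits)

text \<open>Parity excludes 2, so \<open>p dvd d\<close>; and \<open>(d - 1)^2 - 4\<close> is
  \<open>d * (d - 2) - 3\<close>, which leaves \<open>p dvd 3\<close>.\<close>

lemma prime_dvd_dbar_disc:
  fixes p :: int
  assumes "prime p" "p dvd dbar d" "p dvd (d - 1)\<^sup>2 - 4"
  shows "p = 3"
proof -
  have "p \<noteq> 2" using assms even_dbar[of d] by auto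
  then have "\<not> p dvd 2" using assms(1) by (metis primes_dvd_imp_eq two_is_prime)
  then have "p dvd d"
    using assms(1,2) by (auto simp: dbar_def prime_dvd_mult_iff split: if_splits)
  then have "p dvd d * (d - 2) - ((d - 1)\<^sup>2 - 4)" using assms(3) by simp
  also have "d * (d - 2) - ((d - 1)\<^sup>2 - 4) = 3" by (simp add: power2_eq_square algebra_simps)
  finally show ?thesis using assms(1) primes_dvd_imp_eq[of p 3] by simp
qed

text \<open>The determinants of the representatives differ from 1 by \<open>- (d * d)\<close> or by
  a multiple of \<open>2 * d\<close>.\<close>

lemma dbar_dvd_even_mult: "dbar d dvd 2 * d * k" "dbar d dvd d * d"
  by (auto simp: dbar_def)

lemma det_trace_Fz:
  "[det (mat2 0 (d - 1) (d + 1) (d - 1)) = 1] (mod dbar d)"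
  "trace (mat2 0 (d - 1) (d + 1) (d - 1)) = d - 1"
proof -
  have "det (mat2 0 (d - 1) (d + 1) (d - 1)) - 1 = - (d * d)"
    by (simp add: det_2 algebra_simps)
  then show "[det (mat2 0 (d - 1) (d + 1) (d - 1)) = 1] (mod dbar d)"
    using dbar_dvd_even_mult(2)[of d] by (simp add: cong_iff_dvd_diff)
qed (simp add: trace_2)

lemma det_trace_Fa:
  assumes "3 dvd d"
  shows "[det (mat2 1 (d + 3) ((4 * d - 3) div 3) (d - 2)) = 1] (mod dbar d)"
    "trace (mat2 1 (d + 3) ((4 * d - 3) div 3) (d - 2)) = d - 1"
proof -
  obtain k where k: "d = 3 * k" using assms by blast
  have "(4 * d - 3) div 3 = 4 * k - 1" using k by simp
  then have "det (mat2 1 (d + 3) ((4 * d - 3) div 3) (d - 2)) - 1 = 2 * d * (- 1 - 2 * k)"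
    using k by (simp add: det_2 algebra_simps)
  then show "[det (mat2 1 (d + 3) ((4 * d - 3) div 3) (d - 2)) = 1] (mod dbar d)"
    using dbar_dvd_even_mult(1)[of d] unfolding cong_iff_dvd_diff by metis
qed (simp add: trace_2)

lemma det_trace_Fa':
  assumes "3 dvd d"
  shows "[det (mat2 1 (d + 3) ((2 * d - 3) div 3) (d - 2)) = 1] (mod dbar d)"
    "trace (mat2 1 (d + 3) ((2 * d - 3) div 3) (d - 2)) = d - 1"
proof -
  obtain k where k: "d = 3 * k" using assms by blast
  have "(2 * d - 3) div 3 = 2 * k - 1" using k by simp
  then have "det (mat2 1 (d + 3) ((2 * d - 3) div 3) (d - 2)) - 1 = 2 * d * (- k)"
    using k by (simp add: det_2 algebra_simps)
  then show "[det (mat2 1 (d + 3) ((2 * d - 3) div 3) (d - 2)) = 1] (mod dbar d)"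
    using dbar_dvd_even_mult(1)[of d] unfolding cong_iff_dvd_diff by metis
qed (simp add: trace_2)

lemma mat_red_3_mat_1_iff:
  "mat_red 3 A = mat_red 3 (mat 1) \<longleftrightarrow>
    [A $ 1 $ 1 = 1] (mod 3) \<and> [A $ 1 $ 2 = 0] (mod 3) \<and> [A $ 2 $ 1 = 0] (mod 3) \<and> [A $ 2 $ 2 = 1] (mod 3)"
  by (auto simp: mat_red_eq_iff forall_2 mat_def)

text \<open>A scalar \<open>a\<close> modulo 3 has trace \<open>2 * a\<close>, and trace -1 modulo 3
  forces \<open>a = 1\<close>.\<close>

lemma identity_mod_3_if_scalar_mod_3:
  assumes d: "3 dvd d" and tr: "[trace A = d - 1] (mod dbar d)"
    and A: "3 dvd A $ 1 $ 2" "3 dvd A $ 2 $ 1" "3 dvd A $ 2 $ 2 - A $ 1 $ 1"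
  shows "mat_red 3 A = mat_red 3 (mat 1)"
proof -
  have "[trace A = d - 1] (mod 3)" using tr d dbar_dvd_iff_3 by (blast intro: cong_dvd_modulus)
  then show ?thesis
    using d A unfolding mat_red_3_mat_1_iff trace_2 cong_iff_dvd_diff by simp presburger
qed

text \<open>For \<open>A = 1 + 3 N\<close> the determinant is \<open>1 + 3 tr N + 9 det N\<close>
  and the trace \<open>2 + 3 tr N\<close>. Modulo 9 the first makes \<open>3 tr N\<close> vanish,
  the second makes it -3.\<close>

lemma not_identity_mod_3_if_9_dvd:
  assumes d: "9 dvd d" and det: "[det A = 1] (mod dbar d)" and tr: "[trace A = d - 1] (mod dbar d)"
  shows "mat_red 3 A \<noteq> mat_red 3 (mat 1)"
proof
  assume "mat_red 3 A = mat_red 3 (mat 1)"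
  then obtain a b c e where A: "A $ 1 $ 1 - 1 = 3 * a" "A $ 1 $ 2 = 3 * b" "A $ 2 $ 1 = 3 * c" "A $ 2 $ 2 - 1 = 3 * e"
    unfolding mat_red_3_mat_1_iff cong_iff_dvd_diff by (auto elim!: dvdE)
  then have A': "A $ 1 $ 1 = 3 * a + 1" "A $ 2 $ 2 = 3 * e + 1" by auto
  have 9: "9 dvd dbar d" using d by (auto simp: dbar_def)
  have "9 dvd 3 * (a + e) + 9 * (a * e - b * c)"
    using cong_dvd_modulus[OF det 9] unfolding cong_iff_dvd_diff det_2 A A' by (simp add: algebra_simps)
  then have "9 dvd 3 * (a + e)" by (simp add: dvd_add_left_iff)
  moreover have "9 dvd 3 * (a + e) + 3 - d"
    using cong_dvd_modulus[OF tr 9] unfolding cong_iff_dvd_diff trace_2 A' by (simp add: algebra_simps)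
  ultimately show False using d by presburger
qed

lemma conjugacy_classes_disjoint_mod_3:
  assumes d: "d \<ge> 4" "3 dvd d" and B: "[det B = 1] (mod dbar d)" "mat_red 3 B = mat_red 3 (mat 1)"
  shows "conjugacy_class (ESL2 (dbar d)) (Fz d) \<inter> conjugacy_class (ESL2 (dbar d)) (mat_red (dbar d) B) = {}"
proof -
  define n where "n = dbar d"
  have n: "n > 0" "3 dvd n" using d by (simp_all add: n_def dbar_pos dbar_dvd_iff_3)
  interpret group "ESL2 n" by (rule group_ESL2[OF n(1)])
  let ?F = "mat2 0 (d - 1) (d + 1) (d - 1)"
  have detF: "[det ?F = 1] (mod n)" using det_trace_Fz n_def by simp
  have detB: "[det B = 1] (mod n)" using B n_def by simp
  have F: "mat_red n ?F \<in> carrier (ESL2 n)" "mat_red n B \<in> carrier (ESL2 n)"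
    using mat_red_in_ESL2[OF n(1)] detF detB by blast+
  have "mat_red n ?F \<notin> conjugacy_class (ESL2 n) (mat_red n B)"
  proof
    assume "mat_red n ?F \<in> conjugacy_class (ESL2 n) (mat_red n B)"
    then obtain g where g: "[det g = 1] (mod n) \<or> [det g = -1] (mod n)"
      and eq: "mat_red n (?F ** g) = mat_red n (g ** B)"
      unfolding mem_conjugacy_class_ESL2_iff[OF n(1) detF detB] by blast
    \<comment> \<open>Modulo 3 the matrix \<open>g\<close> would be fixed by left multiplication
      with \<open>?F\<close>. The first row of that equation makes the two rows of \<open>g\<close>
      proportional, so \<open>det g\<close> would vanish modulo 3.\<close>
    from eq have "mat_red 3 (?F ** g) = mat_red 3 (g ** B)"
      unfolding mat_red_eq_iff using n(2) cong_dvd_modulus by blast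
    also have "\<dots> = mat_red 3 g"
      using B(2) by (metis mat_red_mult_right matrix_mul_rid)
    finally have "[(d - 1) * g $ 2 $ 1 = g $ 1 $ 1] (mod 3)" "[(d - 1) * g $ 2 $ 2 = g $ 1 $ 2] (mod 3)"
      by (auto simp: mat_red_eq_iff forall_2 mult_nth_2)
    then have "[(d - 1) * g $ 2 $ 1 * g $ 2 $ 2 - (d - 1) * g $ 2 $ 2 * g $ 2 $ 1 = det g] (mod 3)"
      unfolding det_2 by (intro cong_diff cong_mult cong_refl)
    then have "[0 = det g] (mod 3)" by (simp add: mult_ac)
    moreover have "[det g = 1] (mod 3) \<or> [det g = -1] (mod 3)"
      using g n(2) cong_dvd_modulus by blast
    ultimately show False unfolding cong_iff_dvd_diff by presburger
  qed
  then have "conjugacy_class (ESL2 n) (mat_red n ?F) \<inter> conjugacy_class (ESL2 n) (mat_red n B) = {}"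
    using F conjugacy_class_sym conjugacy_class_trans by blast
  then show ?thesis by (simp add: Fz_def n_def)
qed

lemma conjugate_identity_mod_3_dbar:
  assumes d: "d \<ge> 4" and B: "[det B = 1] (mod dbar d)" "[trace B = d - 1] (mod dbar d)"
    and n9: "\<not> 9 dvd d" and d3: "3 dvd d" and B3: "mat_red 3 B = mat_red 3 (mat 1)"
    and A: "A \<in> carrier (ESL2 (dbar d))" "[det A = 1] (mod dbar d)" "[trace A = d - 1] (mod dbar d)"
    and A3: "mat_red 3 A = mat_red 3 (mat 1)"
  shows "A \<in> conjugacy_class (ESL2 (dbar d)) (mat_red (dbar d) B)"
proof -
  obtain m where m: "dbar d = 3 * m" using d3 dbar_dvd_iff_3 by blast
  have "m > 0" using dbar_pos[OF d] m by simp
  have "\<not> 3 dvd m" using m n9 unfolding dbar_def by (auto split: if_splits) presburger+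
  then have "coprime 3 m"
    by (intro prime_imp_coprime) simp_all
  have "mat_red (3 * m) A \<in> conjugacy_class (ESL2 (3 * m)) (mat_red (3 * m) B)"
  proof (rule conjugate_identity_mod_3[OF \<open>m > 0\<close> \<open>coprime 3 m\<close>])
    show "odd (d - 1)" if "even m" using that m even_dbar[of d] by simp
    show "p = 3" if "prime p" "p dvd m" "p dvd (d - 1)\<^sup>2 - 4" for p
      using that prime_dvd_dbar_disc[of p d] m by simp
  qed (use A B A3 B3 m in auto)
  then show ?thesis using ESL2_mat_red[OF dbar_pos[OF d] A(1)] m by simp
qed

section \<open>The classification\<close>

theorem theorem3p12:
  fixes d :: int
  assumes "d \<ge> 4"
  defines "G \<equiv> ESL2 (dbar d)"
  defines "S \<equiv> {A \<in> carrier G. [det A = 1] (mod dbar d) \<and> [trace A = d - 1] (mod dbar d)}"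
  shows "(\<not> [d = 3] (mod 9) \<and> \<not> [d = 6] (mod 9) \<longrightarrow>
            S = conjugacy_class G (Fz d)) \<and>
         ([d = 3] (mod 9) \<longrightarrow>
            S = conjugacy_class G (Fz d) \<union> conjugacy_class G (Fa d) \<and>
            conjugacy_class G (Fz d) \<inter> conjugacy_class G (Fa d) = {}) \<and>
         ([d = 6] (mod 9) \<longrightarrow>
            S = conjugacy_class G (Fz d) \<union> conjugacy_class G (Fa' d) \<and>
            conjugacy_class G (Fz d) \<inter> conjugacy_class G (Fa' d) = {})"
proof -
  have n: "dbar d > 0" using dbar_pos assms(1) by blast
  have sub: "conjugacy_class G (mat_red (dbar d) B) \<subseteq> S"
    if B: "[det B = 1] (mod dbar d)" "[trace B = d - 1] (mod dbar d)" for B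
  proof
    fix A assume A: "A \<in> conjugacy_class G (mat_red (dbar d) B)"
    have "mat_red (dbar d) B \<in> carrier G" using mat_red_in_ESL2[OF n] B(1) by (simp add: G_def)
    from conjugacy_class_ESL2_det_trace[OF n this[unfolded G_def] A[unfolded G_def]]
    show "A \<in> S" unfolding S_def G_def
      using B det_mat_red[of "dbar d" B] trace_mat_red[of "dbar d" B] by (blast intro: cong_trans)
  qed
  have Fz: "conjugacy_class G (Fz d) \<subseteq> S"
    unfolding Fz_def using det_trace_Fz by (intro sub) auto
  have classify: "A \<in> conjugacy_class G (Fz d) \<or> 3 dvd d \<and> \<not> 9 dvd d \<and> mat_red 3 A = mat_red 3 (mat 1)"
    if "A \<in> S" for A
  proof (cases "3 dvd d \<and> 3 dvd A $ 1 $ 2 \<and> 3 dvd A $ 2 $ 1 \<and> 3 dvd A $ 2 $ 2 - A $ 1 $ 1")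
    case True
    then show ?thesis
      using that identity_mod_3_if_scalar_mod_3 not_identity_mod_3_if_9_dvd by (auto simp: S_def)
  next
    case False
    have A: "A \<in> carrier (ESL2 (dbar d))" "[det A = 1] (mod dbar d)" "[trace A = d - 1] (mod dbar d)"
      using that by (auto simp: S_def G_def)
    have "mat_red (dbar d) A \<in> conjugacy_class (ESL2 (dbar d)) (Fz d)"
      unfolding Fz_def
    proof (rule conjugate_nonscalar_mod_3[OF n even_dbar prime_dvd_dbar_disc])
      \<comment> \<open>The off-diagonal entries of this matrix differ by 2, so 3 cannot divide
        both.\<close>
      show "\<not> (3 dvd dbar d \<and> 3 dvd mat2 0 (d - 1) (d + 1) (d - 1) $ 1 $ 2 \<and>
          3 dvd mat2 0 (d - 1) (d + 1) (d - 1) $ 2 $ 1 \<and>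
          3 dvd mat2 0 (d - 1) (d + 1) (d - 1) $ 2 $ 2 - mat2 0 (d - 1) (d + 1) (d - 1) $ 1 $ 1)"
        unfolding dbar_dvd_iff_3 mat2_nth by presburger
    qed (use A False det_trace_Fz[of d] dbar_dvd_iff_3[of d] in auto)
    then show ?thesis using ESL2_mat_red[OF n A(1)] by (simp add: G_def)
  qed
  \<comment> \<open>Any \<open>B\<close> with the right determinant and trace that is the identity
    modulo 3 represents the second class, which treats \<open>Fa\<close> and \<open>Fa'\<close>
    alike.\<close>
  have two: "S = conjugacy_class G (Fz d) \<union> conjugacy_class G (mat_red (dbar d) B) \<and>
      conjugacy_class G (Fz d) \<inter> conjugacy_class G (mat_red (dbar d) B) = {}"
    if d3: "3 dvd d" and n9: "\<not> 9 dvd d" and B: "[det B = 1] (mod dbar d)" "trace B = d - 1"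
      and B3: "mat_red 3 B = mat_red 3 (mat 1)" for B
  proof
    have B': "[trace B = d - 1] (mod dbar d)" using B(2) by simp
    have "A \<in> conjugacy_class G (mat_red (dbar d) B)" if "A \<in> S" "mat_red 3 A = mat_red 3 (mat 1)" for A
      using conjugate_identity_mod_3_dbar[OF assms(1) B(1) B' n9 d3 B3, of A] that by (auto simp: S_def G_def)
    then show "S = conjugacy_class G (Fz d) \<union> conjugacy_class G (mat_red (dbar d) B)"
      using classify Fz sub[OF B(1) B'] by blast
    show "conjugacy_class G (Fz d) \<inter> conjugacy_class G (mat_red (dbar d) B) = {}"
      unfolding G_def using conjugacy_classes_disjoint_mod_3[OF assms(1) d3 B(1) B3] .
  qed
  show ?thesis
  proof (intro conjI impI)
    assume "\<not> [d = 3] (mod 9) \<and> \<not> [d = 6] (mod 9)"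
    then have "\<not> (3 dvd d \<and> \<not> 9 dvd d)" unfolding cong_iff_dvd_diff by presburger
    then show "S = conjugacy_class G (Fz d)" using classify Fz by blast
  next
    assume d: "[d = 3] (mod 9)"
    then have d3: "3 dvd d" and n9: "\<not> 9 dvd d" unfolding cong_iff_dvd_diff by presburger+
    \<comment> \<open>The lower left entry needs \<open>9 dvd 4 * d - 3\<close>, which holds for
      \<open>d = 3\<close> modulo 9; for \<open>d = 6\<close> it is \<open>2 * d - 3\<close> that 9
      divides.\<close>
    have "mat_red 3 (mat2 1 (d + 3) ((4 * d - 3) div 3) (d - 2)) = mat_red 3 (mat 1)"
      using d unfolding mat_red_3_mat_1_iff mat2_nth cong_iff_dvd_diff by presburger
    note F = two[OF d3 n9 det_trace_Fa[OF d3] this, folded Fa_def]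
    show "S = conjugacy_class G (Fz d) \<union> conjugacy_class G (Fa d)"
      "conjugacy_class G (Fz d) \<inter> conjugacy_class G (Fa d) = {}"
      using F by blast+
  next
    assume d: "[d = 6] (mod 9)"
    then have d3: "3 dvd d" and n9: "\<not> 9 dvd d" unfolding cong_iff_dvd_diff by presburger+
    have "mat_red 3 (mat2 1 (d + 3) ((2 * d - 3) div 3) (d - 2)) = mat_red 3 (mat 1)"
      using d unfolding mat_red_3_mat_1_iff mat2_nth cong_iff_dvd_diff by presburger
    note F = two[OF d3 n9 det_trace_Fa'[OF d3] this, folded Fa'_def]
    show "S = conjugacy_class G (Fz d) \<union> conjugacy_class G (Fa' d)"
      "conjugacy_class G (Fz d) \<inter> conjugacy_class G (Fa' d) = {}"
      using F by blast+
  qed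
qed

end
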